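(* Let $m$ and $s$ be positive integers with $s<m$, and let $S=\{\mathbf u\in\mathbb R^m:\|\mathbf u_+\|_0\le s\}$. For $\mathbf z\in S$, the Fréchet normal cone of $S$ at $\mathbf z$ is $$\widehat N_S(\mathbf z)=\begin{cases}\{\mathbf d\in\mathbb R^m:\ d_i=0\ \text{if } z_i\ne 0,\ \ d_i\ge 0\ \text{if } z_i=0\}, & \|\mathbf z_+\|_0=s,\\ \{0\}, & \|\mathbf z_+\|_0<s.\end{cases}$$
   Context: For $\mathbf u\in\mathbb R^m$, $\mathbf u_+$ is the entrywise positive part $\max\{u_i,0\}$ and $\|\cdot\|_0$ counts nonzero entries. For a nonempty set $\Omega\subseteq\mathbb R^m$ and $\mathbf z\in\Omega$, the Bouligand tangent cone is $T_\Omega(\mathbf z)=\{\mathbf d\in\mathbb R^m:\ \exists\,\eta_k\ge 0,\ \{\mathbf z^k\}\subseteq\Omega,\ \lim_{k\to\infty}\mathbf z^k=\mathbf z,\ \lim_{k\to\infty}\eta_k(\mathbf z^k-\mathbf z)=\mathbf d\}$ and the Fréchet normal cone is $\widehat N_\Omega(\mathbf z)=\{\mathbf d\in\mathbb R^m:\ \langle\mathbf d,\mathbf u\rangle\le 0\ \ \forall\,\mathbf u\in T_\Omega(\mathbf z)\}$. *)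

theory Defs
  imports "HOL-Analysis.Analysis"
begin

definition pos_part :: "real ^ 'n \<Rightarrow> real ^ 'n" where
  "pos_part u = (\<chi> i. max (u $ i) 0)"

definition l0_norm :: "real ^ 'n \<Rightarrow> nat" where
  "l0_norm u = card {i. u $ i \<noteq> 0}"

text \<open>The two cones are meant for \<open>z \<in> \<Omega>\<close>; the definitions themselves do not require it.\<close>

definition bouligand_tangent_cone :: "'a::real_normed_vector set \<Rightarrow> 'a \<Rightarrow> 'a set" where
  "bouligand_tangent_cone \<Omega> z =
    {d. \<exists>(\<eta> :: nat \<Rightarrow> real) (zs :: nat \<Rightarrow> 'a).
          (\<forall>k. \<eta> k \<ge> 0) \<and> (\<forall>k. zs k \<in> \<Omega>) \<and> zs \<longlonglongrightarrow> z \<and>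
          (\<lambda>k. \<eta> k *\<^sub>R (zs k - z)) \<longlonglongrightarrow> d}"

definition frechet_normal_cone :: "'a::real_inner set \<Rightarrow> 'a \<Rightarrow> 'a set" where
  "frechet_normal_cone \<Omega> z = {d. \<forall>u \<in> bouligand_tangent_cone \<Omega> z. d \<bullet> u \<le> 0}"

definition pos_sparse_set :: "nat \<Rightarrow> (real ^ 'n) set" where
  "pos_sparse_set s = {u. l0_norm (pos_part u) \<le> s}"

end

theory Submission
  imports Defs
begin

text \<open>
  Everything follows from an explicit description of the tangent cone. To first order, a
  coordinate of a point moving from \<open>z\<close> in direction \<open>u\<close> is positive if \<open>z $ i > 0\<close>, or if
  \<open>z $ i = 0\<close> and \<open>u $ i > 0\<close>. Call the set of these coordinates the directional positive support
  of \<open>u\<close> at \<open>z\<close>. The direction \<open>u\<close> is tangent exactly when this set has at most \<open>s\<close> elements: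
  all of these coordinates are eventually positive along any sequence realising \<open>u\<close>, and
  conversely the ray \<open>z + t u\<close> has no other positive coordinates for small \<open>t > 0\<close>
  (\<open>mem_tangent_cone_pos_sparse_iff\<close>).

  Since \<open>d \<bullet> axis i c = d $ i * c\<close>, testing a normal vector \<open>d\<close> against the tangent direction
  \<open>axis i (d $ i)\<close> forces \<open>d $ i = 0\<close>. This test is available for every \<open>i\<close> if \<open>z\<close> has fewer than
  \<open>s\<close> positive entries. If \<open>z\<close> has exactly \<open>s\<close> positive entries, no new coordinate may become
  positive, so the test is available only if \<open>z $ i \<noteq> 0\<close> or \<open>d $ i \<le> 0\<close>; and every tangent
  direction is nonpositive on the zero coordinates of \<open>z\<close>, which makes each remaining \<open>d\<close> normal.
\<close>

lemma l0_norm_pos_part: "l0_norm (pos_part u) = card {i. 0 < u $ i}"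
  unfolding l0_norm_def pos_part_def
  by (rule arg_cong[where f = card]) (auto simp: max_def)

lemma mem_pos_sparse_set_iff: "u \<in> pos_sparse_set s \<longleftrightarrow> card {i. 0 < u $ i} \<le> s"
  by (simp add: pos_sparse_set_def l0_norm_pos_part)

lemma feasible_direction_in_tangent_cone:
  fixes z u :: "'a::real_normed_vector"
  assumes "\<forall>\<^sub>F t in at_right 0. z + t *\<^sub>R u \<in> \<Omega>"
  shows "u \<in> bouligand_tangent_cone \<Omega> z"
proof -
  obtain \<delta> :: real where \<delta>: "0 < \<delta>" "\<And>t. 0 < t \<Longrightarrow> t < \<delta> \<Longrightarrow> z + t *\<^sub>R u \<in> \<Omega>"
    using assms by (auto simp: eventually_at_right_field)
  define t where "t k = \<delta> * inverse (real (Suc (Suc k)))" for k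
  have t_pos: "0 < t k" for k
    using \<delta>(1) by (simp add: t_def)
  have "t k < \<delta>" for k
    using \<delta>(1) by (simp add: t_def field_simps add_pos_nonneg)
  then have mem: "z + t k *\<^sub>R u \<in> \<Omega>" for k
    using \<delta>(2) t_pos by blast
  have "t \<longlonglongrightarrow> \<delta> * 0"
    unfolding t_def by (rule tendsto_mult[OF tendsto_const LIMSEQ_Suc[OF LIMSEQ_inverse_real_of_nat]])
  then have "(\<lambda>k. z + t k *\<^sub>R u) \<longlonglongrightarrow> z + 0 *\<^sub>R u"
    by (intro tendsto_intros) simp
  moreover have "(\<lambda>k. inverse (t k) *\<^sub>R (z + t k *\<^sub>R u - z)) = (\<lambda>k. u)"
  proof
    show "inverse (t k) *\<^sub>R (z + t k *\<^sub>R u - z) = u" for k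
      using t_pos[of k] by simp
  qed
  ultimately show ?thesis
    unfolding bouligand_tangent_cone_def mem_Collect_eq
    using mem t_pos
    by (intro exI[of _ "\<lambda>k. inverse (t k)"] exI[of _ "\<lambda>k. z + t k *\<^sub>R u"])
      (simp add: less_imp_le)
qed

definition dir_pos_support :: "real ^ 'n \<Rightarrow> real ^ 'n \<Rightarrow> 'n set" where
  "dir_pos_support z u = {i. 0 < z $ i \<or> (z $ i = 0 \<and> 0 < u $ i)}"

text \<open>
  A coordinate with \<open>z $ i < 0\<close> stays negative for small \<open>t\<close> by continuity, and one with
  \<open>z $ i = 0\<close> takes the sign of \<open>u $ i\<close>; finitely many coordinates share a common bound on \<open>t\<close>.
\<close>

lemma eventually_pos_support_ray:
  fixes z u :: "real ^ 'n"
  shows "\<forall>\<^sub>F t in at_right 0. {i. 0 < (z + t *\<^sub>R u) $ i} \<subseteq> dir_pos_support z u"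
proof -
  have "\<forall>\<^sub>F t in at_right 0. 0 < (z + t *\<^sub>R u) $ i \<longrightarrow> i \<in> dir_pos_support z u" for i
  proof (cases "z $ i < 0")
    case True
    have "((\<lambda>t. z $ i + t * u $ i) \<longlongrightarrow> z $ i + 0 * u $ i) (at_right 0)"
      by (intro tendsto_intros)
    then have "\<forall>\<^sub>F t in at_right 0. z $ i + t * u $ i < 0"
      using True by (intro order_tendstoD(2)) auto
    then show ?thesis
      by eventually_elim simp
  next
    case False
    show ?thesis
      using eventually_at_right_less[of "0::real"]
    proof eventually_elim
      case (elim t)
      with False show ?case
        by (auto simp: dir_pos_support_def zero_less_mult_iff)
    qed
  qed
  then have "\<forall>\<^sub>F t in at_right 0. \<forall>i. 0 < (z + t *\<^sub>R u) $ i \<longrightarrow> i \<in> dir_pos_support z u"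
    by (rule eventually_all_finite)
  then show ?thesis
    by eventually_elim blast
qed

text \<open>
  The limits of \<open>zs\<close> and of the scaled differences are approached with the correct strict sign, and
  a nonnegative factor \<open>\<eta>\<close> cannot turn a nonpositive coordinate into a positive one.
\<close>

lemma eventually_dir_pos_support_subset:
  fixes z u :: "real ^ 'n"
  assumes zs: "zs \<longlonglongrightarrow> z" and quot: "(\<lambda>k. \<eta> k *\<^sub>R (zs k - z)) \<longlonglongrightarrow> u" and \<eta>: "\<And>k. 0 \<le> \<eta> k"
  shows "\<forall>\<^sub>F k in sequentially. dir_pos_support z u \<subseteq> {i. 0 < zs k $ i}"
proof -
  have "\<forall>\<^sub>F k in sequentially. i \<in> dir_pos_support z u \<longrightarrow> 0 < zs k $ i" for i
  proof (cases "i \<in> dir_pos_support z u")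
    case True
    then consider "0 < z $ i" | "z $ i = 0" "0 < u $ i"
      by (auto simp: dir_pos_support_def)
    then show ?thesis
    proof cases
      case 1
      then have "\<forall>\<^sub>F k in sequentially. 0 < zs k $ i"
        by (rule order_tendstoD(1)[OF tendsto_vec_nth[OF zs]])
      then show ?thesis
        by eventually_elim simp
    next
      case 2
      then have "\<forall>\<^sub>F k in sequentially. 0 < (\<eta> k *\<^sub>R (zs k - z)) $ i"
        by (intro order_tendstoD(1)[OF tendsto_vec_nth[OF quot]])
      then show ?thesis
      proof eventually_elim
        case (elim k)
        with 2 \<eta>[of k] show ?case
          by (auto simp: zero_less_mult_iff)
      qed
    qed
  qed simp
  then have "\<forall>\<^sub>F k in sequentially. \<forall>i. i \<in> dir_pos_support z u \<longrightarrow> 0 < zs k $ i"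
    by (rule eventually_all_finite)
  then show ?thesis
    by eventually_elim blast
qed

lemma mem_tangent_cone_pos_sparse_iff:
  fixes z u :: "real ^ 'n"
  shows "u \<in> bouligand_tangent_cone (pos_sparse_set s) z \<longleftrightarrow> card (dir_pos_support z u) \<le> s"
proof
  assume "u \<in> bouligand_tangent_cone (pos_sparse_set s) z"
  then obtain \<eta> zs where \<eta>: "\<And>k. 0 \<le> \<eta> k" and mem: "\<And>k. zs k \<in> pos_sparse_set s"
    and lims: "zs \<longlonglongrightarrow> z" "(\<lambda>k. \<eta> k *\<^sub>R (zs k - z)) \<longlonglongrightarrow> u"
    by (auto simp: bouligand_tangent_cone_def)
  obtain k where "dir_pos_support z u \<subseteq> {i. 0 < zs k $ i}"
    using eventually_happens[OF eventually_dir_pos_support_subset[OF lims \<eta>]] by auto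
  then have "card (dir_pos_support z u) \<le> card {i. 0 < zs k $ i}"
    by (intro card_mono) auto
  also have "\<dots> \<le> s"
    using mem[of k] by (simp add: mem_pos_sparse_set_iff)
  finally show "card (dir_pos_support z u) \<le> s" .
next
  assume card: "card (dir_pos_support z u) \<le> s"
  have "\<forall>\<^sub>F t in at_right 0. z + t *\<^sub>R u \<in> pos_sparse_set s"
    using eventually_pos_support_ray[of z u]
  proof eventually_elim
    case (elim t)
    then have "card {i. 0 < (z + t *\<^sub>R u) $ i} \<le> card (dir_pos_support z u)"
      by (intro card_mono) auto
    with card show ?case
      by (simp add: mem_pos_sparse_set_iff)
  qed
  then show "u \<in> bouligand_tangent_cone (pos_sparse_set s) z"
    by (rule feasible_direction_in_tangent_cone)
qed

lemma normal_cone_component_zero: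
  fixes z d :: "real ^ 'n"
  assumes "d \<in> frechet_normal_cone (pos_sparse_set s) z"
    and "card (dir_pos_support z (axis i (d $ i))) \<le> s"
  shows "d $ i = 0"
proof -
  have "axis i (d $ i) \<in> bouligand_tangent_cone (pos_sparse_set s) z"
    using assms(2) by (simp add: mem_tangent_cone_pos_sparse_iff)
  then have "d \<bullet> axis i (d $ i) \<le> 0"
    using assms(1) unfolding frechet_normal_cone_def by blast
  then have "d $ i * d $ i \<le> 0"
    by (simp add: inner_axis)
  then show ?thesis
    by (metis mult_eq_0_iff order_antisym zero_le_square)
qed

theorem proposition2p4:
  fixes z :: "real ^ 'm" and s :: nat
  assumes "0 < s" and "s < CARD('m)"
    and "z \<in> pos_sparse_set s"
  shows "frechet_normal_cone (pos_sparse_set s) z =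
    (if l0_norm (pos_part z) = s
     then {d. \<forall>i. (z $ i \<noteq> 0 \<longrightarrow> d $ i = 0) \<and> (z $ i = 0 \<longrightarrow> d $ i \<ge> 0)}
     else {0})"
proof (cases "l0_norm (pos_part z) = s")
  case True
  then have card: "card {i. 0 < z $ i} = s"
    by (simp add: l0_norm_pos_part)
  have "d \<in> frechet_normal_cone (pos_sparse_set s) z \<longleftrightarrow>
      (\<forall>i. (z $ i \<noteq> 0 \<longrightarrow> d $ i = 0) \<and> (z $ i = 0 \<longrightarrow> d $ i \<ge> 0))" for d
  proof
    assume d: "d \<in> frechet_normal_cone (pos_sparse_set s) z"
    have zero: "d $ i = 0" if "z $ i \<noteq> 0 \<or> d $ i \<le> 0" for i
    proof (rule normal_cone_component_zero[OF d])
      have "dir_pos_support z (axis i (d $ i)) = {i. 0 < z $ i}"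
        using that by (auto simp: dir_pos_support_def axis_def split: if_splits)
      with card show "card (dir_pos_support z (axis i (d $ i))) \<le> s"
        by simp
    qed
    have "d $ i \<ge> 0" for i
      using zero[of i] by (cases "d $ i \<le> 0") auto
    with zero show "\<forall>i. (z $ i \<noteq> 0 \<longrightarrow> d $ i = 0) \<and> (z $ i = 0 \<longrightarrow> d $ i \<ge> 0)"
      by blast
  next
    assume d: "\<forall>i. (z $ i \<noteq> 0 \<longrightarrow> d $ i = 0) \<and> (z $ i = 0 \<longrightarrow> d $ i \<ge> 0)"
    have "d \<bullet> u \<le> 0" if "u \<in> bouligand_tangent_cone (pos_sparse_set s) z" for u
    proof -
      have "card (dir_pos_support z u) \<le> card {i. 0 < z $ i}"
        using that card by (simp add: mem_tangent_cone_pos_sparse_iff)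
      \<comment> \<open>The positive coordinates of \<open>z\<close> already exhaust the bound \<open>s\<close>, so \<open>u\<close> adds none.\<close>
      then have "{i. 0 < z $ i} = dir_pos_support z u"
        by (intro card_seteq) (auto simp: dir_pos_support_def)
      then have u: "u $ i \<le> 0" if "z $ i = 0" for i
        using that by (force simp: dir_pos_support_def)
      have "d $ i * u $ i \<le> 0" for i
        using d u[of i] by (cases "z $ i = 0") (auto intro: mult_nonneg_nonpos)
      then show ?thesis
        by (simp add: inner_vec_def sum_nonpos)
    qed
    then show "d \<in> frechet_normal_cone (pos_sparse_set s) z"
      by (simp add: frechet_normal_cone_def)
  qed
  with True show ?thesis
    by auto
next
  case False
  then have card: "card {i. 0 < z $ i} < s"
    using assms(3) by (simp add: l0_norm_pos_part mem_pos_sparse_set_iff)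
  have "d = 0" if d: "d \<in> frechet_normal_cone (pos_sparse_set s) z" for d
  proof -
    have "d $ i = 0" for i
    proof (rule normal_cone_component_zero[OF d])
      have "dir_pos_support z (axis i (d $ i)) \<subseteq> insert i {i. 0 < z $ i}"
        by (auto simp: dir_pos_support_def axis_def split: if_splits)
      then have "card (dir_pos_support z (axis i (d $ i))) \<le> card (insert i {i. 0 < z $ i})"
        by (intro card_mono) auto
      also have "\<dots> \<le> Suc (card {i. 0 < z $ i})"
        by (simp add: card_insert_if)
      finally show "card (dir_pos_support z (axis i (d $ i))) \<le> s"
        using card by simp
    qed
    then show ?thesis
      by (simp add: vec_eq_iff)
  qed
  moreover have "0 \<in> frechet_normal_cone (pos_sparse_set s) z"
    by (simp add: frechet_normal_cone_def)
  ultimately show ?thesis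
    using False by auto
qed

end
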